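(* Let $G$ be a finite simple graph of order $n$ with chromatic number $\chi(G)\geq n-3$. Then every root $z\in\mathbb{C}$ of the chromatic polynomial $\pi(G,x)$ satisfies $\Re(z)\leq n-1$. Moreover, $\pi(G,x)$ has a root $z$ with $\Re(z)=n-1$ if and only if $\chi(G)=n$.
   Context: For a finite simple graph $G$, the chromatic polynomial $\pi(G,x)$ is the polynomial whose value at each positive integer $x$ is the number of proper vertex colourings of $G$ with $x$ colours; $\chi(G)$ is the least positive integer $x$ with $\pi(G,x)>0$. *)

theory Defs
  imports
    Complex_Main
    "HOL-Library.FuncSet"
    "HOL-Computational_Algebra.Polynomial"
    "Graph_Theory.Pair_Digraph"
begin

text \<open>
  A finite simple graph is a \<^locale>\<open>pair_graph\<close> of the Graph Theory entry: a finite vertex set with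
  a symmetric, irreflexive arc relation, each edge being represented by its two arcs.
\<close>

definition proper_colourings :: "'a pair_pre_digraph \<Rightarrow> nat \<Rightarrow> ('a \<Rightarrow> nat) set" where
  "proper_colourings G x =
     {c \<in> pverts G \<rightarrow>\<^sub>E {..<x}. \<forall>(u, v) \<in> parcs G. c u \<noteq> c v}"

text \<open>
  The description operator is justified by \<open>chromatic_poly_ex1\<close> below.
\<close>

definition chromatic_poly :: "'a pair_pre_digraph \<Rightarrow> real poly" where
  "chromatic_poly G =
     (THE p. \<forall>x::nat. 0 < x \<longrightarrow> poly p (real x) = real (card (proper_colourings G x)))"

definition chromatic_number :: "'a pair_pre_digraph \<Rightarrow> nat" where
  "chromatic_number G = (LEAST x. 0 < x \<and> 0 < poly (chromatic_poly G) (real x))"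


lemma finite_proper_colourings:
  assumes "finite (pverts G)"
  shows "finite (proper_colourings G x)"
proof -
  have "finite (pverts G \<rightarrow>\<^sub>E {..<x})"
    using assms by (intro finite_PiE) auto
  thus ?thesis
    unfolding proper_colourings_def by (rule rev_finite_subset) auto
qed

definition onto_colourings :: "'a pair_pre_digraph \<Rightarrow> nat set \<Rightarrow> ('a \<Rightarrow> nat) set" where
  "onto_colourings G C =
     {c \<in> pverts G \<rightarrow>\<^sub>E C. c ` pverts G = C \<and> (\<forall>(u, v) \<in> parcs G. c u \<noteq> c v)}"

lemma onto_colourings_map:
  assumes G: "pair_graph G" and h: "bij_betw h C D"
  shows "card (onto_colourings G C) \<le> card (onto_colourings G D)"
proof (cases "finite D")
  case True
  interpret pair_graph G by fact
  define F where "F = (\<lambda>c. restrict (h \<circ> c) (pverts G))"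
  have inj: "inj_on F (onto_colourings G C)"
  proof (rule inj_onI)
    fix c d assume c: "c \<in> onto_colourings G C" and d: "d \<in> onto_colourings G C" and eq: "F c = F d"
    show "c = d"
    proof (rule PiE_ext)
      show "c \<in> pverts G \<rightarrow>\<^sub>E C" "d \<in> pverts G \<rightarrow>\<^sub>E C"
        using c d by (auto simp: onto_colourings_def)
      fix v assume v: "v \<in> pverts G"
      have "h (c v) = h (d v)" using fun_cong[OF eq, of v] v by (simp add: F_def)
      moreover have "c v \<in> C" "d v \<in> C" using c d v by (auto simp: onto_colourings_def)
      ultimately show "c v = d v" using h by (auto simp: bij_betw_def inj_on_def)
    qed
  qed
  have sub: "F ` onto_colourings G C \<subseteq> onto_colourings G D"
  proof safe
    fix c assume c: "c \<in> onto_colourings G C"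
    hence im: "c ` pverts G = C" by (auto simp: onto_colourings_def)
    have "F c ` pverts G = h ` c ` pverts G" by (auto simp: F_def)
    hence im': "F c ` pverts G = D" using im h by (simp add: bij_betw_def)
    have "F c u \<noteq> F c v" if "(u, v) \<in> parcs G" for u v
    proof -
      have "u \<in> pverts G" "v \<in> pverts G" using that by (auto dest: in_arcsD1 in_arcsD2)
      moreover have "c u \<noteq> c v" using c that by (auto simp: onto_colourings_def)
      ultimately show ?thesis
        using h im by (auto simp: F_def bij_betw_def inj_on_def)
    qed
    moreover have "F c \<in> pverts G \<rightarrow>\<^sub>E D"
      using im' by (auto simp: F_def)
    ultimately show "F c \<in> onto_colourings G D"
      using im' by (auto simp: onto_colourings_def)
  qed
  have "finite (pverts G \<rightarrow>\<^sub>E D)"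
    using True pair_finite_verts by (intro finite_PiE) auto
  hence "finite (onto_colourings G D)"
    unfolding onto_colourings_def by (rule rev_finite_subset) auto
  thus ?thesis using card_inj_on_le[OF inj sub] by blast
next
  case False
  interpret pair_graph G by fact
  have "infinite C" using False h bij_betw_finite by blast
  hence "onto_colourings G C = {}"
    using pair_finite_verts by (auto simp: onto_colourings_def)
  thus ?thesis by simp
qed

lemma card_proper_colourings:
  assumes G: "pair_graph G"
  shows "card (proper_colourings G x) =
    (\<Sum>k\<le>card (pverts G). (x choose k) * card (onto_colourings G {..<k}))"
proof -
  interpret pair_graph G by fact
  let ?n = "card (pverts G)"
  have fin: "finite (onto_colourings G C)" if "finite C" for C
  proof -
    have "finite (pverts G \<rightarrow>\<^sub>E C)"
      using that pair_finite_verts by (intro finite_PiE) auto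
    thus ?thesis unfolding onto_colourings_def by (rule rev_finite_subset) auto
  qed
  have same: "card (onto_colourings G C) = card (onto_colourings G {..<card C})"
    if finC: "finite C" for C
  proof -
    obtain h where h: "bij_betw h C {..<card C}"
      using ex_bij_betw_finite_nat[OF finC] by (auto simp: atLeast0LessThan)
    show ?thesis
      using onto_colourings_map[OF G h] onto_colourings_map[OF G bij_betw_inv_into[OF h]] by simp
  qed
  have zero: "onto_colourings G {..<k} = {}" if "k > ?n" for k
  proof (rule ccontr)
    assume "onto_colourings G {..<k} \<noteq> {}"
    then obtain c where "c ` pverts G = {..<k}" by (auto simp: onto_colourings_def)
    hence "k \<le> ?n" using card_image_le[OF pair_finite_verts, of c] by simp
    thus False using that by simp
  qed
  have "proper_colourings G x = (\<Union>C\<in>Pow {..<x}. onto_colourings G C)"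
    by (auto simp: proper_colourings_def onto_colourings_def PiE_def Pi_def)
  moreover have "finite (onto_colourings G C)" if "C \<in> Pow {..<x}" for C
    using that by (intro fin) (auto intro: finite_subset)
  moreover have "onto_colourings G C \<inter> onto_colourings G D = {}" if "C \<noteq> D" for C D
    using that by (auto simp: onto_colourings_def)
  ultimately have "card (proper_colourings G x) = (\<Sum>C\<in>Pow {..<x}. card (onto_colourings G C))"
    by (simp add: card_UN_disjoint)
  also have "\<dots> = (\<Sum>C\<in>Pow {..<x}. card (onto_colourings G {..<card C}))"
    by (intro sum.cong refl same) (auto intro: finite_subset)
  also have "\<dots> = (\<Sum>k\<le>x. \<Sum>C\<in>{C\<in>Pow {..<x}. card C = k}. card (onto_colourings G {..<card C}))"
    by (rule sum.group[symmetric]) (auto intro: subset_eq_atLeast0_lessThan_card simp: lessThan_atLeast0)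
  also have "\<dots> = (\<Sum>k\<le>x. (x choose k) * card (onto_colourings G {..<k}))"
  proof (intro sum.cong refl)
    fix k
    have "card {C\<in>Pow {..<x}. card C = k} = x choose k"
      using n_subsets[of "{..<x}" k] by simp
    thus "(\<Sum>C\<in>{C\<in>Pow {..<x}. card C = k}. card (onto_colourings G {..<card C}))
      = (x choose k) * card (onto_colourings G {..<k})" by simp
  qed
  also have "\<dots> = (\<Sum>k\<le>max x ?n. (x choose k) * card (onto_colourings G {..<k}))"
    by (rule sum.mono_neutral_left) auto
  also have "\<dots> = (\<Sum>k\<le>?n. (x choose k) * card (onto_colourings G {..<k}))"
    by (rule sum.mono_neutral_right) (auto simp: zero)
  finally show ?thesis .
qed

lemma chromatic_poly_ex1:
  assumes G: "pair_graph G"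
  shows "\<exists>!p::real poly. \<forall>x::nat. 0 < x \<longrightarrow> poly p (real x) = real (card (proper_colourings G x))"
proof (rule ex_ex1I)
  define b :: "nat \<Rightarrow> real poly" where
    "b k = smult (1 / fact k) (\<Prod>i<k. [:- real i, 1:])" for k
  have b: "poly (b k) (real x) = real (x choose k)" for k x
    by (simp add: b_def poly_prod binomial_gbinomial gbinomial_prod_rev atLeast0LessThan)
  define p where "p = (\<Sum>k\<le>card (pverts G). smult (real (card (onto_colourings G {..<k}))) (b k))"
  have "poly p (real x) = real (card (proper_colourings G x))" for x
    by (simp add: p_def poly_sum b card_proper_colourings[OF G] mult.commute)
  thus "\<exists>p::real poly. \<forall>x::nat. 0 < x \<longrightarrow> poly p (real x) = real (card (proper_colourings G x))"
    by blast
next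
  fix p q :: "real poly"
  assume *: "\<forall>x::nat. 0 < x \<longrightarrow> poly p (real x) = real (card (proper_colourings G x))"
    "\<forall>x::nat. 0 < x \<longrightarrow> poly q (real x) = real (card (proper_colourings G x))"
  have "infinite (real ` {0<..})"
    by (subst finite_image_iff) (auto simp: infinite_Ioi)
  moreover have "real ` {0<..} \<subseteq> {x. poly (p - q) x = 0}"
    using * by auto
  ultimately have "infinite {x. poly (p - q) x = 0}"
    using finite_subset by blast
  thus "p = q" using poly_roots_finite[of "p - q"] by auto
qed

lemma poly_chromatic_poly:
  assumes "pair_graph G" "0 < x"
  shows "poly (chromatic_poly G) (real x) = real (card (proper_colourings G x))"
  using theI'[OF chromatic_poly_ex1[OF assms(1)]] assms(2) unfolding chromatic_poly_def by blast

end

theory Submission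
  imports Defs "HOL-Library.Disjoint_Sets"
begin

text \<open>
  Let \<open>a\<^sub>j\<close> be the number of partitions of the vertex set into \<open>n - j\<close> stable sets, so that
  \<open>\<pi>(G, x)\<close> is the sum of \<open>a\<^sub>j x (x - 1) \<dots> (x - n + j + 1)\<close>. As \<open>\<chi>(G) \<ge> n - 3\<close>, only
  \<open>j \<le> 3\<close> contributes, and with \<open>w = x - n + 1\<close> the polynomial is a falling factorial, whose
  roots have real part below \<open>n - 1\<close>, times the cubic
  \<open>w (w + 1) (w + 2) + a\<^sub>1 (w + 1) (w + 2) + a\<^sub>2 (w + 2) + a\<^sub>3\<close>.
  Every stable partition with \<open>k < n\<close> blocks arises from one with \<open>k + 1\<close> blocks by merging the two
  blocks that meet some non-edge. As there are at most \<open>a\<^sub>1\<close> non-edges, \<open>a\<^sub>2 \<le> a\<^sub>1\<^sup>2\<close> and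
  \<open>a\<^sub>3 \<le> a\<^sub>1 a\<^sub>2\<close>. By the Routh-Hurwitz criterion the cubic then has all its roots in the open left
  half-plane, unless \<open>a\<^sub>1 = 0\<close>, in which case \<open>G\<close> is complete.
\<close>

section \<open>Stable partitions, their blocks and colour classes\<close>

definition stable_partitions :: "'a pair_pre_digraph \<Rightarrow> nat \<Rightarrow> 'a set set set" where
  "stable_partitions G k =
     {P. partition_on (pverts G) P \<and> card P = k \<and> (\<forall>B\<in>P. \<forall>u\<in>B. \<forall>v\<in>B. (u, v) \<notin> parcs G)}"

definition nonedges :: "'a pair_pre_digraph \<Rightarrow> 'a set set" where
  "nonedges G =
     {e. e \<subseteq> pverts G \<and> card e = 2 \<and> (\<forall>u\<in>e. \<forall>v\<in>e. (u, v) \<notin> parcs G)}"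

definition block :: "'a set set \<Rightarrow> 'a \<Rightarrow> 'a set" where
  "block P v = (THE B. B \<in> P \<and> v \<in> B)"

text \<open>Indexing by the attained colours only keeps empty classes out, as a partition
  requires.\<close>

definition colour_classes :: "'a set \<Rightarrow> ('a \<Rightarrow> 'b) \<Rightarrow> 'a set set" where
  "colour_classes V c = (\<lambda>i. {v \<in> V. c v = i}) ` c ` V"

lemma partition_on_unique:
  assumes "partition_on A P" "B \<in> P" "C \<in> P" "v \<in> B" "v \<in> C"
  shows "B = C"
  using assms by (auto simp: partition_on_def disjoint_def)

lemma block_eq:
  assumes "partition_on A P" "B \<in> P" "v \<in> B"
  shows "block P v = B"
  unfolding block_def
  by (rule the_equality) (use assms partition_on_unique[OF assms(1)] in blast)+

lemma block_in:
  assumes "partition_on A P" "v \<in> A"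
  shows "block P v \<in> P" "v \<in> block P v"
proof -
  obtain B where "B \<in> P" "v \<in> B"
    using assms by (auto simp: partition_on_def)
  with block_eq[OF assms(1) this] show "block P v \<in> P" "v \<in> block P v" by auto
qed

lemma partition_on_colour_classes: "partition_on A (colour_classes A c)"
  by (rule partition_onI) (auto simp: colour_classes_def disjnt_iff)

text \<open>Distinct blocks receive distinct colours because \<open>f\<close> is injective, so the
  classes are again the blocks. This recovers a partition from its colouring and gives the
  injectivity in \<open>card_onto_colourings\<close>.\<close>

lemma colour_classes_block:
  assumes P: "partition_on A P" and f: "inj_on f P"
  shows "colour_classes A (\<lambda>v\<in>A. f (block P v)) = P"
proof -
  have "{w \<in> A. (\<lambda>v\<in>A. f (block P v)) w = f B} = B" if "B \<in> P" for B
  proof -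
    have "B \<subseteq> A" using P that by (auto simp: partition_on_def)
    have "f (block P w) = f B \<longleftrightarrow> w \<in> B" if w: "w \<in> A" for w
      using inj_on_eq_iff[OF f block_in(1)[OF P w] \<open>B \<in> P\<close>] block_in[OF P w]
        block_eq[OF P \<open>B \<in> P\<close>] by auto
    with \<open>B \<subseteq> A\<close> show ?thesis by auto
  qed
  moreover have "(\<lambda>v\<in>A. f (block P v)) ` A = f ` P"
  proof safe
    fix v assume "v \<in> A"
    thus "(\<lambda>v\<in>A. f (block P v)) v \<in> f ` P" using block_in(1)[OF P] by auto
  next
    fix B assume B: "B \<in> P"
    then obtain v where v: "v \<in> B" using partition_onD3[OF P] by (metis all_not_in_conv)
    hence "v \<in> A" using P B by (auto simp: partition_on_def)
    thus "f B \<in> (\<lambda>v\<in>A. f (block P v)) ` A"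
      using block_eq[OF P B v] by (auto intro!: image_eqI[of _ _ v])
  qed
  ultimately show ?thesis
    by (simp add: colour_classes_def image_image)
qed

section \<open>Roots of the cubic factor\<close>

lemma routh_hurwitz_cubic:
  fixes b c d :: real and w :: complex
  assumes pos: "b > 0" "c > 0" "d > 0" and hurwitz: "d < b * c"
    and root: "w ^ 3 + of_real b * w ^ 2 + of_real c * w + of_real d = 0"
  shows "Re w < 0"
proof (rule ccontr)
  define u v where "u = Re w" and "v = Im w"
  assume "\<not> Re w < 0"
  hence u: "u \<ge> 0" by (simp add: u_def)
  have w: "w = Complex u v" by (simp add: u_def v_def)
  have re: "u^3 - 3*u*v^2 + b*(u^2 - v^2) + c*u + d = 0"
    using arg_cong[OF root, of Re] unfolding w
    by (simp add: power2_eq_square power3_eq_cube algebra_simps)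
  have im: "v * (3*u^2 - v^2 + 2*b*u + c) = 0"
    using arg_cong[OF root, of Im] unfolding w
    by (simp add: power2_eq_square power3_eq_cube algebra_simps)
  show False
  proof (cases "v = 0")
    case True
    \<comment> \<open>A real root \<open>u \<ge> 0\<close> would make a sum of nonnegative terms and
      \<open>d > 0\<close> vanish.\<close>
    have "u^3 \<ge> 0" "b*u^2 \<ge> 0" "c*u \<ge> 0" using u pos by simp_all
    moreover have "u^3 + b*u^2 + c*u + d = 0" using re True by simp
    ultimately show False using pos by linarith
  next
    case False
    hence v2: "v^2 = 3*u^2 + 2*b*u + c" using im by simp
    \<comment> \<open>Eliminating \<open>v^2\<close> from the real part leaves a polynomial in
      \<open>u \<ge> 0\<close> alone, with nonnegative coefficients and constant term
      \<open>b*c - d > 0\<close>.\<close>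
    have "8*u^3 + 8*b*u^2 + (2*c + 2*b^2)*u + (b*c - d) = 0"
      using re unfolding v2 by (simp add: power2_eq_square power3_eq_cube algebra_simps)
    moreover have "u^3 \<ge> 0" "b*u^2 \<ge> 0" "(2*c + 2*b^2)*u \<ge> 0" using u pos by simp_all
    ultimately show False using hurwitz by linarith
  qed
qed

text \<open>If \<open>a\<^sub>1 = 0\<close>, the two bounds force
  \<open>a\<^sub>2 = a\<^sub>3 = 0\<close> and the roots are 0, -1 and -2. Otherwise the expanded
  cubic satisfies the Routh-Hurwitz conditions, with
  \<open>a\<^sub>3 \<le> a\<^sub>1 * a\<^sub>2\<close> keeping \<open>b * c - d\<close>
  positive.\<close>

lemma falling_cubic_root:
  fixes a\<^sub>1 a\<^sub>2 a\<^sub>3 :: real and w :: complex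
  assumes nonneg: "0 \<le> a\<^sub>1" "0 \<le> a\<^sub>2" "0 \<le> a\<^sub>3" and le: "a\<^sub>2 \<le> a\<^sub>1 * a\<^sub>1" "a\<^sub>3 \<le> a\<^sub>1 * a\<^sub>2"
    and root: "w * (w + 1) * (w + 2) + of_real a\<^sub>1 * ((w + 1) * (w + 2))
      + of_real a\<^sub>2 * (w + 2) + of_real a\<^sub>3 = 0"
    and Re: "Re w \<ge> 0"
  shows "a\<^sub>1 = 0 \<and> w = 0"
proof (cases "a\<^sub>1 = 0")
  case True
  hence "a\<^sub>2 = 0" "a\<^sub>3 = 0" using nonneg le by auto
  with True root have "w * (w + 1) * (w + 2) = 0" by simp
  moreover have "w + 1 \<noteq> 0" "w + 2 \<noteq> 0" using Re by (auto simp: complex_eq_iff)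
  ultimately show ?thesis using True by simp
next
  case False
  define b c d where "b = 3 + a\<^sub>1" and "c = 2 + 3 * a\<^sub>1 + a\<^sub>2" and "d = 2 * a\<^sub>1 + 2 * a\<^sub>2 + a\<^sub>3"
  have pos: "a\<^sub>1 > 0" using False nonneg by simp
  have "b * c - d = 6 + 9 * a\<^sub>1 + 3 * (a\<^sub>1 * a\<^sub>1) + a\<^sub>2 + (a\<^sub>1 * a\<^sub>2 - a\<^sub>3)"
    by (simp add: b_def c_def d_def algebra_simps)
  moreover have "a\<^sub>1 * a\<^sub>1 \<ge> 0" by simp
  ultimately have "d < b * c" using pos nonneg le by linarith
  moreover have "w ^ 3 + of_real b * w ^ 2 + of_real c * w + of_real d = 0"
    using root
    by (simp add: b_def c_def d_def power2_eq_square power3_eq_cube algebra_simps)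
  ultimately have "Re w < 0"
    using pos nonneg by (intro routh_hurwitz_cubic[of b c d w]) (auto simp: b_def c_def d_def)
  thus ?thesis using Re by simp
qed

lemma poly_map_poly_of_real:
  "poly (map_poly of_real p) (of_real x :: 'a :: {real_algebra_1, comm_semiring_0}) = of_real (poly p x)"
  by (induction p) (auto simp: map_poly_pCons)

section \<open>Surjective colourings and stable partitions\<close>

context pair_graph
begin

lemma not_loop: "(v, v) \<notin> parcs G"
  using no_loops[of "(v, v)"] by auto

lemma finite_stable_partitions: "finite (stable_partitions G k)"
  by (rule finite_subset[OF _ finitely_many_partition_on[OF pair_finite_verts]])
    (auto simp: stable_partitions_def)

lemma finite_nonedges: "finite (nonedges G)"
  by (rule finite_subset[of _ "Pow (pverts G)"]) (auto simp: nonedges_def)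

text \<open>A proper colouring onto \<open>k\<close> colours amounts to the stable partition into
  its colour classes together with a bijection from classes to colours, and there are
  \<open>fact k\<close> such bijections.\<close>

lemma card_onto_colourings:
  "card (onto_colourings G {..<k}) = fact k * card (stable_partitions G k)"
proof -
  let ?V = "pverts G"
  \<comment> \<open>For a partition into \<open>k\<close> blocks these injections into
    \<open>k\<close> colours are exactly the bijections.\<close>
  define I where "I P = {f \<in> P \<rightarrow>\<^sub>E {..<k}. inj_on f P}" for P :: "'a set set"
  define F where "F = (\<lambda>(P, f). \<lambda>v\<in>?V. f (block P v) :: nat)"
  have sp: "partition_on ?V P" "finite P" "card P = k" if "P \<in> stable_partitions G k" for P
    using that finite_elements[OF pair_finite_verts] by (auto simp: stable_partitions_def)
  have cardI: "card (I P) = fact k" if "P \<in> stable_partitions G k" for P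
    using card_inj_on_subset_funcset[of P "{..<k}" P] sp[OF that]
    by (simp add: I_def fact_prod_rev)
  have "bij_betw F (Sigma (stable_partitions G k) I) (onto_colourings G {..<k})"
    unfolding bij_betw_def
  proof
    have cc: "colour_classes ?V (F (P, f)) = P" if "P \<in> stable_partitions G k" "f \<in> I P" for P f
      using colour_classes_block[of ?V P f] that sp by (simp add: F_def I_def)
    show "inj_on F (Sigma (stable_partitions G k) I)"
    proof (rule inj_onI, clarify)
      fix P f Q g
      assume P: "P \<in> stable_partitions G k" "f \<in> I P" and Q: "Q \<in> stable_partitions G k" "g \<in> I Q"
        and eq: "F (P, f) = F (Q, g)"
      have PQ: "P = Q" using cc[OF P] cc[OF Q] eq by simp
      have "f = g"
      proof (rule PiE_ext)
        show "f \<in> P \<rightarrow>\<^sub>E {..<k}" "g \<in> P \<rightarrow>\<^sub>E {..<k}" using P Q PQ by (auto simp: I_def)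
        fix B assume B: "B \<in> P"
        note part = sp(1)[OF P(1)]
        obtain v where v: "v \<in> B" using partition_onD3[OF part] B by (metis all_not_in_conv)
        have "v \<in> ?V" using part B v by (auto simp: partition_on_def)
        thus "f B = g B"
          using fun_cong[OF eq, of v] block_eq[OF part B v] PQ by (simp add: F_def)
      qed
      with PQ show "P = Q \<and> f = g" by simp
    qed
    show "F ` Sigma (stable_partitions G k) I = onto_colourings G {..<k}"
    proof (intro equalityI subsetI)
      fix c assume "c \<in> F ` Sigma (stable_partitions G k) I"
      then obtain P f where P: "P \<in> stable_partitions G k" and f: "f \<in> I P" and c: "c = F (P, f)"
        by auto
      note part = sp(1)[OF P]
      have fim: "f ` P = {..<k}"
        using f sp[OF P] by (intro card_subset_eq) (auto simp: I_def card_image)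
      have cim: "c ` ?V = f ` P"
      proof safe
        fix v assume "v \<in> ?V"
        thus "c v \<in> f ` P" using block_in(1)[OF part] by (auto simp: c F_def)
      next
        fix B assume B: "B \<in> P"
        then obtain v where v: "v \<in> B" using partition_onD3[OF part] by (metis all_not_in_conv)
        hence "v \<in> ?V" using part B by (auto simp: partition_on_def)
        thus "f B \<in> c ` ?V"
          using block_eq[OF part B v] by (auto simp: c F_def intro!: image_eqI[of _ _ v])
      qed
      have "c u \<noteq> c v" if uv: "(u, v) \<in> parcs G" for u v
      proof
        assume eq: "c u = c v"
        have V: "u \<in> ?V" "v \<in> ?V" using uv by (auto dest: in_arcsD1 in_arcsD2)
        hence "f (block P u) = f (block P v)" using eq by (simp add: c F_def)
        hence "block P u = block P v"
          using f block_in(1)[OF part] V by (auto simp: I_def inj_on_def)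
        hence "v \<in> block P u" using block_in(2)[OF part V(2)] by simp
        thus False
          using uv P block_in[OF part V(1)] by (auto simp: stable_partitions_def)
      qed
      moreover have "c \<in> ?V \<rightarrow>\<^sub>E {..<k}"
        using cim fim by (auto simp: c F_def)
      ultimately show "c \<in> onto_colourings G {..<k}"
        using cim fim by (auto simp: onto_colourings_def)
    next
      fix c assume c: "c \<in> onto_colourings G {..<k}"
      define P where "P = colour_classes ?V c"
      \<comment> \<open>Any representative will do, since \<open>c\<close> is constant on each
        class.\<close>
      define f where "f = (\<lambda>B\<in>P. c (SOME v. v \<in> B))"
      have part: "partition_on ?V P" by (simp add: P_def partition_on_colour_classes)
      have cim: "c ` ?V = {..<k}" using c by (simp add: onto_colourings_def)
      have colour: "f {v \<in> ?V. c v = i} = i" if "i < k" for i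
      proof -
        have i: "i \<in> c ` ?V" using cim that by simp
        hence "\<exists>v. v \<in> {v \<in> ?V. c v = i}" by blast
        hence "(SOME v. v \<in> {v \<in> ?V. c v = i}) \<in> {v \<in> ?V. c v = i}" by (rule someI_ex)
        moreover have "{v \<in> ?V. c v = i} \<in> P" using i by (simp add: P_def colour_classes_def)
        ultimately show ?thesis by (simp add: f_def)
      qed
      have Peq: "P = (\<lambda>i. {v \<in> ?V. c v = i}) ` {..<k}"
        by (simp add: P_def colour_classes_def cim)
      \<comment> \<open>\<open>f\<close> reads the colour back off its class, so distinct colours
        have distinct classes.\<close>
      have inj: "inj_on (\<lambda>i. {v \<in> ?V. c v = i}) {..<k}"
        by (rule inj_on_inverseI[of _ f]) (use colour in auto)
      have "card P = k" by (simp add: Peq card_image[OF inj])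
      moreover have "(u, v) \<notin> parcs G" if "B \<in> P" "u \<in> B" "v \<in> B" for B u v
        using that c by (auto simp: Peq onto_colourings_def)
      ultimately have "P \<in> stable_partitions G k"
        using part by (auto simp: stable_partitions_def)
      moreover have "f \<in> I P"
        using colour by (auto simp: I_def Peq f_def inj_on_def)
      moreover have "F (P, f) = c"
      proof
        fix v
        show "F (P, f) v = c v"
        proof (cases "v \<in> ?V")
          case True
          hence cv: "c v < k" using cim by auto
          hence "block P v = {w \<in> ?V. c w = c v}"
            using True by (intro block_eq[OF part]) (auto simp: Peq)
          thus ?thesis using True colour[OF cv] by (simp add: F_def)
        next
          case False
          thus ?thesis using c by (auto simp: F_def onto_colourings_def PiE_def extensional_def)
        qed
      qed
      ultimately show "c \<in> F ` Sigma (stable_partitions G k) I" by force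
    qed
  qed
  hence "card (onto_colourings G {..<k}) = card (Sigma (stable_partitions G k) I)"
    by (rule bij_betw_same_card[symmetric])
  also have "\<dots> = (\<Sum>P\<in>stable_partitions G k. card (I P))"
  proof (rule card_SigmaI)
    show "\<forall>P\<in>stable_partitions G k. finite (I P)"
    proof
      fix P assume "P \<in> stable_partitions G k"
      hence "finite (P \<rightarrow>\<^sub>E {..<k})" using sp(2) by (intro finite_PiE) auto
      thus "finite (I P)" by (rule rev_finite_subset) (auto simp: I_def)
    qed
  qed (rule finite_stable_partitions)
  also have "\<dots> = fact k * card (stable_partitions G k)" by (simp add: cardI)
  finally show ?thesis .
qed

section \<open>Bounds on the numbers of stable partitions\<close>

lemma stable_partitions_card:
  "stable_partitions G (card (pverts G)) = {(\<lambda>v. {v}) ` pverts G}"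
proof (intro equalityI subsetI)
  let ?V = "pverts G"
  fix P assume P: "P \<in> stable_partitions G (card ?V)"
  hence part: "partition_on ?V P" and c: "card P = card ?V" by (auto simp: stable_partitions_def)
  have "P = block P ` ?V"
  proof (intro equalityI subsetI)
    fix B assume B: "B \<in> P"
    then obtain v where v: "v \<in> B" using partition_onD3[OF part] by (metis all_not_in_conv)
    hence "v \<in> ?V" using part B by (auto simp: partition_on_def)
    with block_eq[OF part B v] show "B \<in> block P ` ?V" by blast
  qed (use block_in(1)[OF part] in auto)
  \<comment> \<open>\<open>block P\<close> maps the vertices onto a set of the same finite size, so
    no two vertices share a block.\<close>
  hence inj: "inj_on (block P) ?V"
    using c pair_finite_verts by (metis eq_card_imp_inj_on)
  have "block P v = {v}" if v: "v \<in> ?V" for v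
  proof -
    have "w = v" if "w \<in> block P v" for w
    proof -
      have "w \<in> ?V" using that part block_in(1)[OF part v] by (auto simp: partition_on_def)
      moreover have "block P w = block P v"
        using block_eq[OF part block_in(1)[OF part v] that] .
      ultimately show ?thesis using inj v by (auto simp: inj_on_def)
    qed
    thus ?thesis using block_in(2)[OF part v] by auto
  qed
  with \<open>P = block P ` ?V\<close> show "P \<in> {(\<lambda>v. {v}) ` ?V}" by (metis image_cong singletonI)
next
  fix P assume "P \<in> {(\<lambda>v. {v}) ` pverts G}"
  thus "P \<in> stable_partitions G (card (pverts G))"
    using not_loop
    by (auto simp: stable_partitions_def partition_on_singletons card_image inj_on_def)
qed

text \<open>A non-edge \<open>e\<close> together with singletons for the other vertices is a stable
  partition, and \<open>e\<close> is recovered as its only block of size 2.\<close>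

lemma card_nonedges_le: "card (nonedges G) \<le> card (stable_partitions G (card (pverts G) - 1))"
proof (rule card_inj_on_le)
  let ?V = "pverts G"
  define m where "m e = insert e ((\<lambda>v. {v}) ` (?V - e))" for e
  show "inj_on m (nonedges G)"
  proof (rule inj_onI)
    fix e d assume "e \<in> nonedges G" "d \<in> nonedges G" and eq: "m e = m d"
    moreover from this have "e \<in> m d" by (auto simp: m_def)
    ultimately show "e = d" by (auto simp: m_def nonedges_def)
  qed
  show "m ` nonedges G \<subseteq> stable_partitions G (card ?V - 1)"
  proof
    fix P assume "P \<in> m ` nonedges G"
    then obtain e where e: "e \<in> nonedges G" and P: "P = m e" by auto
    have e': "e \<subseteq> ?V" "card e = 2" "e \<noteq> {}" using e by (auto simp: nonedges_def)
    have fin: "finite e" using e'(1) pair_finite_verts finite_subset by blast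
    \<comment> \<open>This makes \<open>Suc (card ?V - 2)\<close> equal to
      \<open>card ?V - 1\<close> despite truncated subtraction.\<close>
    have "card ?V \<ge> 2" using card_mono[OF pair_finite_verts e'(1)] e'(2) by simp
    have "card (m e) = Suc (card (?V - e))"
      using e' pair_finite_verts by (auto simp: m_def card_insert_if card_image inj_on_def)
    also have "\<dots> = card ?V - 1"
      using e' \<open>card ?V \<ge> 2\<close> by (simp add: card_Diff_subset[OF fin])
    finally have "card P = card ?V - 1" by (simp add: P)
    moreover have "partition_on ?V P"
      using e' unfolding P m_def
      by (subst partition_on_insert) (auto simp: disjnt_iff partition_on_singletons)
    ultimately show "P \<in> stable_partitions G (card ?V - 1)"
      using e not_loop by (auto simp: stable_partitions_def P m_def nonedges_def)
  qed
qed (rule finite_stable_partitions)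

text \<open>Merging the blocks that meet a non-edge covers all stable partitions with
  \<open>k\<close> blocks: one of these blocks contains distinct \<open>u\<close> and
  \<open>v\<close>, and splitting \<open>u\<close> off gives a stable partition with
  \<open>k + 1\<close> blocks from which merging along \<open>{u, v}\<close> leads back.\<close>

lemma card_stable_partitions_le:
  assumes k: "k < card (pverts G)"
  shows "card (stable_partitions G k) \<le> card (nonedges G) * card (stable_partitions G (Suc k))"
proof -
  let ?V = "pverts G"
  define m where "m = (\<lambda>(e, Q). insert (\<Union>{B\<in>Q. B \<inter> e \<noteq> {}}) {B\<in>Q. B \<inter> e = {}} :: 'a set set)"
  have "stable_partitions G k \<subseteq> m ` (nonedges G \<times> stable_partitions G (Suc k))"
  proof
    fix P assume P: "P \<in> stable_partitions G k"
    hence part: "partition_on ?V P" and cP: "card P = k"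
      and st: "\<And>B u v. B \<in> P \<Longrightarrow> u \<in> B \<Longrightarrow> v \<in> B \<Longrightarrow> (u, v) \<notin> parcs G"
      by (auto simp: stable_partitions_def)
    have finP: "finite P" using finite_elements[OF pair_finite_verts part] .
    have sub: "B \<subseteq> ?V" if "B \<in> P" for B using part that by (auto simp: partition_on_def)
    \<comment> \<open>Pigeonhole: blocks of size at most 1 would cover at most \<open>k\<close>
      vertices.\<close>
    have "\<exists>B\<in>P. \<exists>u\<in>B. \<exists>v\<in>B. u \<noteq> v"
    proof (rule ccontr)
      assume *: "\<not> ?thesis"
      have "card B \<le> 1" if "B \<in> P" for B
      proof -
        have "B = {} \<or> (\<exists>u. B = {u})" using * that by blast
        thus ?thesis by auto
      qed
      hence "(\<Sum>B\<in>P. card B) \<le> (\<Sum>B\<in>P. 1)" by (intro sum_mono)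
      moreover have "card ?V = (\<Sum>B\<in>P. card B)"
        using part sub pair_finite_verts by (intro product_partition) (blast intro: finite_subset)+
      moreover have "(\<Sum>B\<in>P. 1) = k" using cP by simp
      ultimately show False using k by linarith
    qed
    then obtain B u v where B: "B \<in> P" "u \<in> B" "v \<in> B" "u \<noteq> v" by blast
    define R where "R = P - {B}"
    have P_eq: "P = insert B R" using B by (auto simp: R_def)
    have BR: "disjnt B (\<Union>R)"
      using partition_on_unique[OF part B(1)] by (auto simp: R_def disjnt_iff)
    have partR: "partition_on (?V - B) R"
      using part unfolding P_eq by (subst (asm) partition_on_insert[OF BR]) auto
    \<comment> \<open>Both halves of \<open>B\<close> are nonempty, as \<open>v\<close> stays in
      \<open>?B\<close>.\<close>
    let ?B = "B - {u}" and ?Q = "insert {u} (insert (B - {u}) R)" and ?e = "{u, v}"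
    have "partition_on (?V - {u} - ?B) R"
      using partR B by (metis Diff_insert insert_Diff Diff_insert2)
    hence "partition_on (?V - {u}) (insert ?B R)"
      using BR B sub[OF B(1)] by (subst partition_on_insert) (auto simp: disjnt_iff)
    hence "partition_on ?V ?Q"
      using BR B sub[OF B(1)] by (subst partition_on_insert) (auto simp: disjnt_iff)
    moreover have "card ?Q = Suc k"
    proof -
      have "{u} \<noteq> ?B" "{u} \<notin> R" "?B \<notin> R" using BR B by (auto simp: disjnt_iff)
      moreover have "finite R" "Suc (card R) = k"
        using finP B cP card_Suc_Diff1[of P B] by (auto simp: R_def)
      ultimately show ?thesis by simp
    qed
    moreover have "(x, y) \<notin> parcs G" if "C \<in> ?Q" "x \<in> C" "y \<in> C" for C x y
      using that st B not_loop by (auto simp: R_def)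
    ultimately have "?Q \<in> stable_partitions G (Suc k)"
      by (auto simp: stable_partitions_def)
    moreover have "?e \<in> nonedges G"
      using B sub[OF B(1)] st[OF B(1)] by (auto simp: nonedges_def)
    moreover have "m (?e, ?Q) = P"
    proof -
      have R: "C \<inter> ?e = {}" if "C \<in> R" for C using BR B that by (auto simp: disjnt_iff)
      \<comment> \<open>Exactly the two halves of \<open>B\<close> meet \<open>{u, v}\<close>, so
        merging restores \<open>B\<close> and leaves \<open>R\<close> alone.\<close>
      have "{C \<in> ?Q. C \<inter> ?e \<noteq> {}} = {{u}, ?B}" using R B by auto
      moreover have "{C \<in> ?Q. C \<inter> ?e = {}} = R" using R B by auto
      moreover have "\<Union>{{u}, ?B} = B" using B by auto
      ultimately show ?thesis unfolding m_def P_eq by simp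
    qed
    ultimately show "P \<in> m ` (nonedges G \<times> stable_partitions G (Suc k))" by force
  qed
  hence "card (stable_partitions G k) \<le> card (nonedges G \<times> stable_partitions G (Suc k))"
    by (rule surj_card_le[rotated]) (simp add: finite_nonedges finite_stable_partitions)
  thus ?thesis by (simp add: card_cartesian_product)
qed

section \<open>Expansion of the chromatic polynomial in falling factorials\<close>

lemma poly_chromatic_poly_complex:
  "poly (map_poly complex_of_real (chromatic_poly G)) z =
     (\<Sum>k\<le>card (pverts G). of_nat (card (stable_partitions G k)) * (\<Prod>i<k. z - of_nat i))"
proof -
  define p where "p = map_poly complex_of_real (chromatic_poly G)"
  define q :: "complex poly" where "q = (\<Sum>k\<le>card (pverts G).
    smult (of_nat (card (stable_partitions G k))) (\<Prod>i<k. [:- of_nat i, 1:]))"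
  have q: "poly q y = (\<Sum>k\<le>card (pverts G).
    of_nat (card (stable_partitions G k)) * (\<Prod>i<k. y - of_nat i))" for y
    by (simp add: q_def poly_sum poly_prod)
  have "poly p (of_nat x) = poly q (of_nat x)" if x: "x > 0" for x
  proof -
    \<comment> \<open>The \<open>fact k\<close> from \<open>card_onto_colourings\<close> turns each
      binomial coefficient into a falling factorial.\<close>
    have binom: "of_nat (x choose k) * fact k = (\<Prod>i<k. of_nat x - of_nat i :: complex)" for k
      by (simp add: binomial_gbinomial gbinomial_prod_rev atLeast0LessThan)
    have "poly p (of_nat x) = of_nat (card (proper_colourings G x))"
      using poly_map_poly_of_real[of "chromatic_poly G" "real x", where 'a = complex]
        poly_chromatic_poly[OF pair_graph_axioms x] by (simp add: p_def)
    also have "\<dots> = poly q (of_nat x)"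
      by (simp add: q card_proper_colourings[OF pair_graph_axioms] card_onto_colourings
          binom[symmetric] mult_ac)
    finally show ?thesis .
  qed
  \<comment> \<open>Agreement at all positive integers gives \<open>p - q\<close> infinitely many
    roots, so it is zero.\<close>
  hence "of_nat ` {0<..} \<subseteq> {x. poly (p - q) x = 0}" by auto
  moreover have "infinite (of_nat ` {0<..} :: complex set)"
    by (subst finite_image_iff) (auto simp: infinite_Ioi inj_on_def)
  ultimately have "infinite {x. poly (p - q) x = 0}"
    using finite_subset by blast
  hence "p = q" using poly_roots_finite[of "p - q"] by auto
  thus ?thesis using q by (simp add: p_def)
qed

section \<open>The chromatic number and stable partitions\<close>

lemma stable_partitions_imp_colouring:
  assumes "stable_partitions G k \<noteq> {}" "k \<le> x" "0 < x"
  shows "0 < poly (chromatic_poly G) (real x)"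
proof -
  have "card (stable_partitions G k) > 0"
    using assms finite_stable_partitions by (simp add: card_gt_0_iff)
  hence "card (onto_colourings G {..<k}) > 0" by (simp add: card_onto_colourings)
  then obtain c where "c \<in> onto_colourings G {..<k}" by (auto simp: card_gt_0_iff)
  hence "c \<in> proper_colourings G x"
    using assms(2) by (auto simp: onto_colourings_def proper_colourings_def PiE_iff)
  hence "card (proper_colourings G x) > 0"
    using finite_proper_colourings[OF pair_finite_verts] by (auto simp: card_gt_0_iff)
  thus ?thesis using poly_chromatic_poly[OF pair_graph_axioms assms(3)] by simp
qed

text \<open>The condition \<open>0 < k\<close> matters for the empty graph, which has a partition
  into 0 blocks but chromatic number 1.\<close>

lemma chromatic_number_le:
  assumes "stable_partitions G k \<noteq> {}" "0 < k"
  shows "chromatic_number G \<le> k"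
  unfolding chromatic_number_def
  by (rule Least_le) (use assms stable_partitions_imp_colouring in auto)

lemma
  shows chromatic_number_pos: "chromatic_number G > 0"
    and chromatic_number_colouring: "0 < poly (chromatic_poly G) (real (chromatic_number G))"
proof -
  \<comment> \<open>The successor keeps the number of colours positive for the empty graph as
    well.\<close>
  have "0 < poly (chromatic_poly G) (real (Suc (card (pverts G))))"
    by (rule stable_partitions_imp_colouring[of "card (pverts G)"])
      (simp_all add: stable_partitions_card)
  hence "\<exists>x. 0 < x \<and> 0 < poly (chromatic_poly G) (real x)" by blast
  from LeastI_ex[OF this] show "chromatic_number G > 0"
    "0 < poly (chromatic_poly G) (real (chromatic_number G))"
    by (simp_all add: chromatic_number_def)
qed

lemma card_stable_partitions_eq_0:
  assumes "pverts G \<noteq> {}" "k < chromatic_number G"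
  shows "card (stable_partitions G k) = 0"
proof (cases "k = 0")
  case True
  have False if "P \<in> stable_partitions G 0" for P
  proof -
    have "partition_on (pverts G) P" "card P = 0" using that by (auto simp: stable_partitions_def)
    moreover from this have "finite P" using pair_finite_verts finite_elements by blast
    ultimately show False using assms(1) partition_onD1 by fastforce
  qed
  thus ?thesis using True by (metis all_not_in_conv card.empty)
next
  case False
  thus ?thesis using chromatic_number_le[of k] assms by fastforce
qed

lemma card_stable_partitions_complete:
  assumes "card (nonedges G) = 0" "k < card (pverts G)"
  shows "card (stable_partitions G k) = 0"
  using card_stable_partitions_le[OF assms(2)] assms(1) by simp

text \<open>The singletons give the upper bound. For the lower one, only the term
  \<open>k = ?n\<close> of the colouring count survives, and the binomial coefficient in it vanishes
  for fewer than \<open>?n\<close> colours.\<close>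

lemma chromatic_number_complete:
  assumes "card (nonedges G) = 0" "pverts G \<noteq> {}"
  shows "chromatic_number G = card (pverts G)"
proof (rule antisym)
  let ?n = "card (pverts G)" and ?x = "chromatic_number G"
  have "?n > 0" using assms(2) pair_finite_verts by (simp add: card_gt_0_iff)
  thus "?x \<le> ?n" by (intro chromatic_number_le) (simp_all add: stable_partitions_card)
  have "0 < card (proper_colourings G ?x)"
    using chromatic_number_colouring poly_chromatic_poly[OF pair_graph_axioms chromatic_number_pos]
    by simp
  also have "\<dots> = (?x choose ?n) * fact ?n"
  proof -
    have "card (onto_colourings G {..<k}) = 0" if "k < ?n" for k
      using that assms by (simp add: card_onto_colourings card_stable_partitions_complete)
    hence "(\<Sum>k<?n. (?x choose k) * card (onto_colourings G {..<k})) = 0" by simp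
    thus ?thesis
      by (simp add: card_proper_colourings[OF pair_graph_axioms] card_onto_colourings
          stable_partitions_card lessThan_Suc_atMost[symmetric])
  qed
  finally show "?n \<le> ?x" by (simp add: zero_less_binomial_iff)
qed

section \<open>Roots with real part at least \<open>n - 1\<close>\<close>

lemma chromatic_root_right:
  assumes nonempty: "pverts G \<noteq> {}"
    and chi: "card (pverts G) \<le> chromatic_number G + 3"
    and root: "poly (map_poly complex_of_real (chromatic_poly G)) z = 0"
    and Re: "Re z \<ge> real (card (pverts G)) - 1"
  shows "card (nonedges G) = 0 \<and> z = of_nat (card (pverts G)) - 1"
proof -
  let ?n = "card (pverts G)"
  define p where "p k = card (stable_partitions G k)" for k
  define w where "w = z - of_nat ?n + 1"
  have w: "Re w \<ge> 0" using Re by (simp add: w_def)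
  have npos: "?n > 0" using nonempty pair_finite_verts by (simp add: card_gt_0_iff)
  have pn: "p ?n = 1" by (simp add: p_def stable_partitions_card)
  have p0: "p k = 0" if "k < chromatic_number G" for k
    using card_stable_partitions_eq_0[OF nonempty that] by (simp add: p_def)
  have N: "card (nonedges G) \<le> p (?n - 1)" using card_nonedges_le by (simp add: p_def)
  have step: "p k \<le> p (?n - 1) * p (Suc k)" if "k < ?n" for k
  proof -
    have "p k \<le> card (nonedges G) * p (Suc k)"
      using card_stable_partitions_le[OF that] by (simp add: p_def)
    also have "\<dots> \<le> p (?n - 1) * p (Suc k)" by (rule mult_le_mono1[OF N])
    finally show ?thesis .
  qed
  have sum: "(\<Sum>k\<le>?n. of_nat (p k) * (\<Prod>i<k. z - of_nat i)) = 0"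
    using root by (simp add: poly_chromatic_poly_complex p_def)
  have "p (?n - 1) = 0 \<and> w = 0"
  proof (cases "?n \<ge> 3")
    case True
    then obtain m where m: "?n = Suc (Suc (Suc m))"
      by (metis add.commute add_2_eq_Suc' add_Suc_right le_Suc_ex numeral_3_eq_3 plus_nat.add_0)
    have zw: "z = w + of_nat m + 2" using m by (simp add: w_def)
    have "p k = 0" if "k < m" for k using that chi m by (intro p0) simp
    hence low: "(\<Sum>k<m. of_nat (p k) * (\<Prod>i<k. z - of_nat i)) = 0" by simp
    \<comment> \<open>Here \<open>m\<close> is \<open>n - 3\<close>, and \<open>p (m + 2)\<close>,
      \<open>p (m + 1)\<close>, \<open>p m\<close> are the coefficients \<open>a\<^sub>1\<close>,
      \<open>a\<^sub>2\<close>, \<open>a\<^sub>3\<close>. The last three factors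
      \<open>z - m\<close>, \<open>z - m - 1\<close>, \<open>z - m - 2\<close> are
      \<open>w + 2\<close>, \<open>w + 1\<close>, \<open>w\<close>.\<close>
    have "(\<Prod>i<m. z - of_nat i) * (w * (w + 1) * (w + 2) + of_nat (p (m + 2)) * ((w + 1) * (w + 2))
      + of_nat (p (m + 1)) * (w + 2) + of_nat (p m)) = 0"
      using sum low pn unfolding m
      by (simp add: lessThan_Suc_atMost[symmetric] zw algebra_simps)
    moreover have "z - of_nat i \<noteq> 0" if "i < m" for i
    proof -
      have "Re z > real i" using Re m that by simp
      thus ?thesis by auto
    qed
    ultimately have "w * (w + 1) * (w + 2) + of_nat (p (m + 2)) * ((w + 1) * (w + 2))
      + of_nat (p (m + 1)) * (w + 2) + of_nat (p m) = 0"
      by simp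
    moreover have "p (m + 1) \<le> p (m + 2) * p (m + 2)" "p m \<le> p (m + 2) * p (m + 1)"
      using step[of "m + 1"] step[of m] m by simp_all
    ultimately have "real (p (m + 2)) = 0 \<and> w = 0"
      using w
      by (intro falling_cubic_root[of _ "real (p (m + 1))" "real (p m)"])
        (simp_all flip: of_nat_mult)
    thus ?thesis using m by simp
  next
    case False
    \<comment> \<open>For \<open>n < 3\<close> there are too few factors to extract the cubic, so
      \<open>n = 1\<close> and \<open>n = 2\<close> are treated directly.\<close>
    have p0: "p 0 = 0" by (rule p0) (rule chromatic_number_pos)
    consider "?n = 1" | "?n = 2" using False npos by linarith
    thus ?thesis
    proof cases
      case 1
      thus ?thesis using sum pn p0 by (simp add: w_def)
    next
      case 2
      have "w * (w + 1) + of_nat (p 1) * (w + 1) = 0"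
        using sum pn p0 unfolding 2
        by (simp add: w_def 2 numeral_2_eq_2 algebra_simps)
      \<comment> \<open>The extra factor \<open>w + 2\<close> turns the quadratic into the cubic
        with \<open>a\<^sub>2 = a\<^sub>3 = 0\<close>.\<close>
      hence "(w * (w + 1) + of_nat (p 1) * (w + 1)) * (w + 2) = 0" by simp
      hence "real (p 1) = 0 \<and> w = 0"
        using w by (intro falling_cubic_root[of _ 0 0]) (simp_all add: algebra_simps)
      thus ?thesis using 2 by simp
    qed
  qed
  thus ?thesis using N by (simp add: w_def algebra_simps)
qed

text \<open>Terms with \<open>k < n\<close> vanish because there are no stable partitions with fewer
  than \<open>n\<close> blocks; the term \<open>k = n\<close> contains the factor
  \<open>z - (n - 1)\<close>.\<close>

lemma chromatic_root_complete:
  assumes nonempty: "pverts G \<noteq> {}" and chi: "chromatic_number G = card (pverts G)"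
  shows "poly (map_poly complex_of_real (chromatic_poly G)) (of_nat (card (pverts G)) - 1) = 0"
proof -
  let ?n = "card (pverts G)"
  have npos: "?n > 0" using nonempty pair_finite_verts by (simp add: card_gt_0_iff)
  have zero: "of_nat (card (stable_partitions G k)) * (\<Prod>i<k. of_nat ?n - 1 - of_nat i :: complex) = 0"
    if "k \<le> ?n" for k
  proof (cases "k = ?n")
    case True
    have "(\<Prod>i<?n. of_nat ?n - 1 - of_nat i :: complex) = 0"
      using npos by (auto intro!: bexI[of _ "?n - 1"] simp: of_nat_diff)
    thus ?thesis by (simp add: True)
  next
    case False
    thus ?thesis using that card_stable_partitions_eq_0[OF nonempty] chi by simp
  qed
  show ?thesis
    unfolding poly_chromatic_poly_complex by (intro sum.neutral ballI zero) simp
qed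

end

theorem theorem2p11:
  fixes G :: "'a pair_pre_digraph" and n :: nat
  assumes "pair_graph G"
    and "n = card (pverts G)"
    and "int (chromatic_number G) \<ge> int n - 3"
  shows "(\<forall>z::complex. poly (map_poly complex_of_real (chromatic_poly G)) z = 0 \<longrightarrow> Re z \<le> real n - 1)
    \<and> ((\<exists>z::complex. poly (map_poly complex_of_real (chromatic_poly G)) z = 0 \<and> Re z = real n - 1)
         \<longleftrightarrow> chromatic_number G = n)"
proof -
  interpret pair_graph G by fact
  show ?thesis
  proof (cases "pverts G = {}")
    \<comment> \<open>The polynomial of the empty graph is the constant 1, without roots, and its
      chromatic number is positive while \<open>n = 0\<close>, so both sides of the equivalence are
      false.\<close>
    case True
    have "poly (map_poly complex_of_real (chromatic_poly G)) z = 1" for z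
      using stable_partitions_card True by (simp add: poly_chromatic_poly_complex)
    thus ?thesis using chromatic_number_pos assms(2) True by simp
  next
    case False
    have chi: "card (pverts G) \<le> chromatic_number G + 3" using assms(2,3) by linarith
    note right = chromatic_root_right[OF False chi]
    show ?thesis
    proof (intro conjI allI impI iffI)
      fix z assume "poly (map_poly complex_of_real (chromatic_poly G)) z = 0"
      thus "Re z \<le> real n - 1"
        \<comment> \<open>A root with \<open>Re z \<ge> n - 1\<close> equals \<open>n - 1\<close>,
          so the bound holds in either case.\<close>
        using right[of z] assms(2) by (cases "Re z \<ge> real n - 1") auto
    next
      assume "\<exists>z. poly (map_poly complex_of_real (chromatic_poly G)) z = 0 \<and> Re z = real n - 1"
      then obtain z where "poly (map_poly complex_of_real (chromatic_poly G)) z = 0"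
        "Re z = real n - 1" by blast
      hence "card (nonedges G) = 0" using right[of z] assms(2) by simp
      thus "chromatic_number G = n"
        using chromatic_number_complete[OF _ False] assms(2) by simp
    next
      assume "chromatic_number G = n"
      thus "\<exists>z. poly (map_poly complex_of_real (chromatic_poly G)) z = 0 \<and> Re z = real n - 1"
        using chromatic_root_complete[OF False] assms(2)
        by (intro exI[of _ "of_nat n - 1"]) simp
    qed
  qed
qed

end
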